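(* Let $F(X)\in\mathbb Z[X]$ be a non-constant monic polynomial and $t\in\mathbb Z$. The Diophantine equation $$F\left(\frac{x_1^2+x_2^2+x_3^2}{x_1x_2x_3}\right)=F(t)$$ has a solution $(x_1,x_2,x_3)$ in positive integers if and only if $F(t)=F(1)$ or $F(t)=F(3)$. Moreover: (1) if $F(1)=F(3)$, all the positive integer solutions can be obtained from the initial solutions $(1,1,1)$ and $(3,3,3)$ by finitely many cluster mutations of $\mathcal A_P$ (that is, each solution is obtained from one of these two); (2) if $F(1)\ne F(3)$, all the positive integer solutions can be obtained from a single one of these initial solutions by finitely many cluster mutations of $\mathcal A_P$: either all of them from $(1,1,1)$, or all of them from $(3,3,3)$.
   Context: $\mathcal A_P$ is the cluster algebra with initial exchange matrix $\begin{pmatrix}0&2&-2\\-2&0&2\\2&-2&0\end{pmatrix}$ (once-punctured torus cluster algebra). Its cluster mutations act on triples by $\mu_1(x_1,x_2,x_3)=\left(\frac{x_2^2+x_3^2}{x_1},x_2,x_3\right)$, $\mu_2(x_1,x_2,x_3)=\left(x_1,\frac{x_1^2+x_3^2}{x_2},x_3\right)$, $\mu_3(x_1,x_2,x_3)=\left(x_1,x_2,\frac{x_1^2+x_2^2}{x_3}\right)$. A triple is obtained from an initial triple by finitely many cluster mutations of $\mathcal A_P$ if it equals the result of applying a finite (possibly empty) sequence of the maps $\mu_1,\mu_2,\mu_3$ to that triple. *)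

theory Defs
  imports Complex_Main "HOL-Computational_Algebra.Polynomial"
begin

text \<open>
  Cluster mutations of the once-punctured torus cluster algebra, with initial exchange matrix
  \<open>((0, 2, -2), (-2, 0, 2), (2, -2, 0))\<close>. Mutation in any direction only changes the sign of this
  matrix, so the exchange relations have the same form at every seed and the mutations act on
  triples without reference to the matrix.
\<close>

definition mu1 :: "rat \<times> rat \<times> rat \<Rightarrow> rat \<times> rat \<times> rat" where
  "mu1 = (\<lambda>(x1, x2, x3). ((x2\<^sup>2 + x3\<^sup>2) / x1, x2, x3))"

definition mu2 :: "rat \<times> rat \<times> rat \<Rightarrow> rat \<times> rat \<times> rat" where
  "mu2 = (\<lambda>(x1, x2, x3). (x1, (x1\<^sup>2 + x3\<^sup>2) / x2, x3))"

definition mu3 :: "rat \<times> rat \<times> rat \<Rightarrow> rat \<times> rat \<times> rat" where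
  "mu3 = (\<lambda>(x1, x2, x3). (x1, x2, (x1\<^sup>2 + x2\<^sup>2) / x3))"

inductive obtained_by_mutations :: "rat \<times> rat \<times> rat \<Rightarrow> rat \<times> rat \<times> rat \<Rightarrow> bool"
  for a :: "rat \<times> rat \<times> rat" where
  initial: "obtained_by_mutations a a"
| step1: "obtained_by_mutations a x \<Longrightarrow> obtained_by_mutations a (mu1 x)"
| step2: "obtained_by_mutations a x \<Longrightarrow> obtained_by_mutations a (mu2 x)"
| step3: "obtained_by_mutations a x \<Longrightarrow> obtained_by_mutations a (mu3 x)"

text \<open>
  Solutions are stored as rational triples with positive integer entries, so that the mutations
  apply to them directly; \<open>map_poly of_int F\<close> is \<open>F\<close> regarded as a polynomial over the rationals.
\<close>

definition pos_int_solutions :: "int poly \<Rightarrow> int \<Rightarrow> (rat \<times> rat \<times> rat) set" where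
  "pos_int_solutions F t =
    {(x1, x2, x3). x1 \<in> \<int> \<and> x2 \<in> \<int> \<and> x3 \<in> \<int> \<and> x1 > 0 \<and> x2 > 0 \<and> x3 > 0 \<and>
       poly (map_poly of_int F) ((x1\<^sup>2 + x2\<^sup>2 + x3\<^sup>2) / (x1 * x2 * x3)) = of_int (poly F t)}"

end

theory Submission
  imports Defs
begin

text \<open>
  Put \<open>k = (x\<^sub>1\<^sup>2 + x\<^sub>2\<^sup>2 + x\<^sub>3\<^sup>2) / (x\<^sub>1 x\<^sub>2 x\<^sub>3)\<close>. Two observations reduce everything to
  Markov's classical descent.

  Since \<open>F\<close> is monic and non-constant, a rational \<open>k\<close> at which \<open>F\<close> takes an integer value is an
  algebraic integer, hence an integer. So a solution is a positive integer solution of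
  \<open>x\<^sup>2 + y\<^sup>2 + z\<^sup>2 = k x y z\<close> for some positive integer \<open>k\<close> with \<open>F(k) = F(t)\<close>.

  For fixed \<open>k\<close>, this equation is quadratic in each variable. By Vieta, the second root in \<open>x\<close> is
  \<open>k y z - x = (y\<^sup>2 + z\<^sup>2) / x\<close>, which is exactly what the mutation replaces \<open>x\<close> by. Mutating at a
  largest entry makes that entry smaller, except at a triple \<open>(c, c, c)\<close>, where the equation says
  \<open>k c = 3\<close> (\<open>largest_entry_descent\<close>). As mutations are involutions, every solution is obtained by
  mutations from such a triple (\<open>obtained_from_constant_triple\<close>). The only possibilities are
  \<open>k = 3\<close> with \<open>(1, 1, 1)\<close> and \<open>k = 1\<close> with \<open>(3, 3, 3)\<close>. So \<open>F(t) = F(3)\<close> if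
  some solution comes from \<open>(1, 1, 1)\<close>, and \<open>F(t) = F(1)\<close> if some solution comes from \<open>(3, 3, 3)\<close>.
  Conversely, under these conditions the two triples are themselves solutions. When
  \<open>F(1) \<noteq> F(3)\<close>, only one of the two can occur.
\<close>

section \<open>Vieta descent\<close>

text \<open>
  The quadratic \<open>T\<^sup>2 - k y z T + y\<^sup>2 + z\<^sup>2\<close> has the roots \<open>x\<close> and \<open>k y z - x\<close>. If both are at least
  \<open>x\<close>, hence at least \<open>y\<close>, its value at \<open>T = y\<close> is nonnegative; for \<open>z \<le> y\<close> this forces
  \<open>k z \<le> 3\<close>. On the other hand \<open>2 x \<le> k y z\<close> and \<open>y \<le> x\<close> give \<open>k z \<ge> 2\<close>, so only two values
  of \<open>k z\<close> are left.
\<close>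

lemma ordered_descent:
  fixes k x y z :: int
  assumes "y > 0" "z > 0" "x \<ge> y" "y \<ge> z"
    and eq: "x\<^sup>2 + y\<^sup>2 + z\<^sup>2 = k * x * y * z"
    and min: "k * y * z - x \<ge> x"
  shows "x = y \<and> x = z \<and> k * x = 3"
proof -
  define m where "m = k * z"
  have min': "2 * x \<le> m * y" and eq': "x\<^sup>2 + y\<^sup>2 + z\<^sup>2 = m * (x * y)"
    using min eq by (simp_all add: m_def algebra_simps)
  have "m > 1"
  proof (rule ccontr)
    assume "\<not> m > 1"
    then have "m * y \<le> 1 * y"
      using assms(1) by (intro mult_right_mono) auto
    then show False
      using min' assms by linarith
  qed
  have "0 \<le> (x - y) * ((m * y - x) - y)"
    using assms min' by (intro mult_nonneg_nonneg) auto
  also have "\<dots> = 2 * y\<^sup>2 + z\<^sup>2 - m * y\<^sup>2"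
    using eq' by (simp add: algebra_simps power2_eq_square)
  finally have root_bound: "m * y\<^sup>2 \<le> 2 * y\<^sup>2 + z\<^sup>2" by simp
  have zy: "z\<^sup>2 \<le> y\<^sup>2"
    using assms by (intro power_mono) auto
  have "m * y\<^sup>2 \<le> 3 * y\<^sup>2"
    using root_bound zy by linarith
  then have "m \<le> 3"
    using \<open>y > 0\<close> by simp
  with \<open>m > 1\<close> consider "m = 2" | "m = 3" by linarith
  then show ?thesis
  proof cases
    case 1
    then have "x = y" using min' assms by simp
    then have "z\<^sup>2 = 0" using eq' 1 by (simp add: power2_eq_square)
    then show ?thesis using assms by simp
  next
    case 2
    have "y\<^sup>2 \<le> z\<^sup>2" using root_bound by (simp add: 2)
    then have "z\<^sup>2 = y\<^sup>2" using zy by simp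
    then have "z = y" using assms by (simp add: power2_eq_iff)
    \<comment> \<open>Now the quadratic is \<open>(T - y) * (T - 2 * y)\<close>, and \<open>x\<close> is its smaller root.\<close>
    have "(x - y) * (x - 2 * y) = 0"
      using eq' 2 \<open>z = y\<close> by (simp add: algebra_simps power2_eq_square)
    then have "x = y" using min' 2 assms by auto
    then show ?thesis using 2 \<open>z = y\<close> by (simp add: m_def)
  qed
qed

lemma largest_entry_descent:
  fixes k x y z :: int
  assumes "x > 0" "y > 0" "z > 0" "x \<ge> y" "x \<ge> z"
    and eq: "x\<^sup>2 + y\<^sup>2 + z\<^sup>2 = k * x * y * z"
  obtains "x = y" "x = z" "k * x = 3"
  | x' where "x' > 0" "x' < x" "x'\<^sup>2 + y\<^sup>2 + z\<^sup>2 = k * x' * y * z" "x * x' = y\<^sup>2 + z\<^sup>2"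
proof (cases "k * y * z - x \<ge> x")
  case True
  have "x = y \<and> x = z \<and> k * x = 3"
  proof (cases "y \<ge> z")
    case le: True
    show ?thesis using ordered_descent[OF assms(2,3,4) le eq True] .
  next
    case False
    then show ?thesis
      using ordered_descent[of z y x k] assms True by (simp add: algebra_simps)
  qed
  then show ?thesis using that(1) by blast
next
  case False
  have vieta: "x * (k * y * z - x) = y\<^sup>2 + z\<^sup>2"
    using eq by (simp add: algebra_simps power2_eq_square)
  have "x * (k * y * z - x) > 0"
    unfolding vieta using assms by (simp add: add_pos_pos)
  then have pos: "k * y * z - x > 0"
    using \<open>x > 0\<close> by (simp add: zero_less_mult_iff)
  have "(k * y * z - x)\<^sup>2 + y\<^sup>2 + z\<^sup>2 = k * (k * y * z - x) * y * z"
    unfolding add.assoc vieta[symmetric] by (simp add: algebra_simps power2_eq_square)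
  then show ?thesis
    using that(2)[of "k * y * z - x"] pos False vieta by simp
qed

section \<open>Mutations as inverse descent steps\<close>

text \<open>
  The three lemmas below undo one descent step: if \<open>x * x'\<close> is the sum of the squares of the other
  two entries, mutation turns \<open>x'\<close> back into \<open>x\<close>.
\<close>

lemma mu1_of_int:
  fixes x x' y z :: int
  assumes "x' > 0" "x * x' = y\<^sup>2 + z\<^sup>2"
  shows "mu1 (of_int x', of_int y, of_int z) = (of_int x, of_int y, of_int z)"
proof -
  have eq: "(of_int x * of_int x' :: rat) = (of_int y)\<^sup>2 + (of_int z)\<^sup>2"
    using arg_cong[OF assms(2), of "of_int :: int \<Rightarrow> rat"] by simp
  then show ?thesis using assms(1) by (simp add: mu1_def flip: eq)
qed

lemma mu2_of_int:
  fixes x y y' z :: int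
  assumes "y' > 0" "y * y' = x\<^sup>2 + z\<^sup>2"
  shows "mu2 (of_int x, of_int y', of_int z) = (of_int x, of_int y, of_int z)"
proof -
  have eq: "(of_int y * of_int y' :: rat) = (of_int x)\<^sup>2 + (of_int z)\<^sup>2"
    using arg_cong[OF assms(2), of "of_int :: int \<Rightarrow> rat"] by simp
  then show ?thesis using assms(1) by (simp add: mu2_def flip: eq)
qed

lemma mu3_of_int:
  fixes x y z z' :: int
  assumes "z' > 0" "z * z' = x\<^sup>2 + y\<^sup>2"
  shows "mu3 (of_int x, of_int y, of_int z') = (of_int x, of_int y, of_int z)"
proof -
  have eq: "(of_int z * of_int z' :: rat) = (of_int x)\<^sup>2 + (of_int y)\<^sup>2"
    using arg_cong[OF assms(2), of "of_int :: int \<Rightarrow> rat"] by simp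
  then show ?thesis using assms(1) by (simp add: mu3_def flip: eq)
qed

text \<open>
  Infinite descent on the sum of the entries: each step mutates at a largest entry and lowers the
  sum, and it can stop only at a triple of equal entries.
\<close>

lemma obtained_from_constant_triple:
  fixes k x y z :: int
  assumes "x > 0" "y > 0" "z > 0" "x\<^sup>2 + y\<^sup>2 + z\<^sup>2 = k * x * y * z"
  shows "\<exists>c>0. k * c = 3 \<and>
    obtained_by_mutations (of_int c, of_int c, of_int c) (of_int x, of_int y, of_int z)"
  using assms
proof (induction "nat (x + y + z)" arbitrary: x y z rule: less_induct)
  case less
  note pos = less.prems(1-3) and eq = less.prems(4)
  consider "x \<ge> y" "x \<ge> z" | "y \<ge> x" "y \<ge> z" | "z \<ge> x" "z \<ge> y" by linarith
  then show ?case
  proof cases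
    case 1
    from pos 1 eq show ?thesis
    proof (cases rule: largest_entry_descent)
      case 1
      with pos show ?thesis by (auto intro: obtained_by_mutations.initial)
    next
      case (2 x')
      with pos less.hyps[of x' y z] obtain c where "c > 0" "k * c = 3"
        "obtained_by_mutations (of_int c, of_int c, of_int c)
          (of_int x', of_int y, of_int z)"
        by auto
      then show ?thesis
        using obtained_by_mutations.step1 mu1_of_int[OF 2(1,4)] by metis
    qed
  next
    case 2
    have eq': "y\<^sup>2 + x\<^sup>2 + z\<^sup>2 = k * y * x * z" using eq by (simp add: algebra_simps)
    from pos(2,1,3) 2 eq' show ?thesis
    proof (cases rule: largest_entry_descent)
      case 1
      with pos show ?thesis by (auto intro: obtained_by_mutations.initial)
    next
      case (2 y')
      then have "x\<^sup>2 + y'\<^sup>2 + z\<^sup>2 = k * x * y' * z" by (simp add: algebra_simps)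
      with 2 pos less.hyps[of x y' z] obtain c where "c > 0" "k * c = 3"
        "obtained_by_mutations (of_int c, of_int c, of_int c)
          (of_int x, of_int y', of_int z)"
        by auto
      then show ?thesis
        using obtained_by_mutations.step2 mu2_of_int[OF 2(1,4)] by metis
    qed
  next
    case 3
    have eq': "z\<^sup>2 + x\<^sup>2 + y\<^sup>2 = k * z * x * y" using eq by (simp add: algebra_simps)
    from pos(3,1,2) 3 eq' show ?thesis
    proof (cases rule: largest_entry_descent)
      case 1
      with pos show ?thesis by (auto intro: obtained_by_mutations.initial)
    next
      case (2 z')
      then have "x\<^sup>2 + y\<^sup>2 + z'\<^sup>2 = k * x * y * z'" by (simp add: algebra_simps)
      with 2 pos less.hyps[of x y z'] obtain c where "c > 0" "k * c = 3"
        "obtained_by_mutations (of_int c, of_int c, of_int c)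
          (of_int x, of_int y, of_int z')"
        by auto
      then show ?thesis
        using obtained_by_mutations.step3 mu3_of_int[OF 2(1,4)] by metis
    qed
  qed
qed

section \<open>Solutions of the polynomial equation\<close>

lemma rat_is_int_if_monic_poly_is_int:
  fixes F :: "int poly" and q :: rat
  assumes "degree F > 0" "lead_coeff F = 1" "poly (map_poly of_int F) q \<in> \<int>"
  shows "q \<in> \<int>"
proof -
  have "algebraic_int (poly (map_poly of_int F) q)"
    using assms(3) by (rule int_imp_algebraic_int)
  then have "algebraic_int q"
    by (rule algebraic_int_root[OF _ refl])
      (use assms(1,2) in \<open>simp_all add: coeff_map_poly degree_map_poly\<close>)
  moreover have "q \<in> \<rat>" by (metis Rats_of_rat of_rat_eq_id id_apply)
  ultimately show ?thesis by (rule rational_algebraic_int_is_int)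
qed

lemma poly_map_poly_of_int:
  "poly (map_poly of_int F) (of_int k :: 'a :: comm_ring_1) = of_int (poly F k)"
  by (induction F) (simp_all add: map_poly_pCons)

lemma solution_obtained_from_initial:
  fixes F :: "int poly"
  assumes "degree F > 0" "lead_coeff F = 1" and sol: "s \<in> pos_int_solutions F t"
  shows "poly F t = poly F 3 \<and> obtained_by_mutations (1, 1, 1) s \<or>
    poly F t = poly F 1 \<and> obtained_by_mutations (3, 3, 3) s"
proof -
  obtain x y z :: int where s: "s = (of_int x, of_int y, of_int z)"
    and pos: "x > 0" "y > 0" "z > 0"
    and F: "poly (map_poly of_int F)
      (((of_int x)\<^sup>2 + (of_int y)\<^sup>2 + (of_int z)\<^sup>2) / (of_int x * of_int y * of_int z))
      = (of_int (poly F t) :: rat)"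
    using sol unfolding pos_int_solutions_def by (auto elim!: Ints_cases)
  then obtain k where k: "((of_int x)\<^sup>2 + (of_int y)\<^sup>2 + (of_int z)\<^sup>2) /
      (of_int x * of_int y * of_int z) = (of_int k :: rat)"
    using rat_is_int_if_monic_poly_is_int[OF assms(1,2)] by (metis Ints_cases Ints_of_int)
  have Fk: "poly F k = poly F t"
    using F unfolding k by (simp add: poly_map_poly_of_int)
  have "(of_int (x\<^sup>2 + y\<^sup>2 + z\<^sup>2) :: rat) = of_int (k * x * y * z)"
    using k pos by (simp add: field_simps)
  then have "x\<^sup>2 + y\<^sup>2 + z\<^sup>2 = k * x * y * z"
    unfolding of_int_eq_iff .
  with pos obtain c where c: "c > 0" "k * c = 3"
    and reach: "obtained_by_mutations (of_int c, of_int c, of_int c) s"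
    using obtained_from_constant_triple s by blast
  have "c \<le> 3" using c by (metis dvd_triv_right zdvd_imp_le zero_less_numeral)
  with c(1) consider "c = 1" | "c = 2" | "c = 3" by linarith
  then have "c = 1 \<and> k = 3 \<or> c = 3 \<and> k = 1"
    using c(2) by cases (simp_all, presburger)
  then show ?thesis using reach Fk by auto
qed

lemma ones_solution_iff: "(1, 1, 1) \<in> pos_int_solutions F t \<longleftrightarrow> poly F t = poly F 3"
  using poly_map_poly_of_int[of F 3, where ?'a = rat] by (auto simp: pos_int_solutions_def)

lemma threes_solution_iff: "(3, 3, 3) \<in> pos_int_solutions F t \<longleftrightarrow> poly F t = poly F 1"
  using poly_map_poly_of_int[of F 1, where ?'a = rat] by (auto simp: pos_int_solutions_def)

theorem proposition1p5:
  fixes F :: "int poly" and t :: int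
  assumes "degree F > 0" and "lead_coeff F = 1"
  shows "(pos_int_solutions F t \<noteq> {} \<longleftrightarrow> poly F t = poly F 1 \<or> poly F t = poly F 3) \<and>
    (poly F 1 = poly F 3 \<longrightarrow>
      (pos_int_solutions F t \<noteq> {} \<longrightarrow> {(1, 1, 1), (3, 3, 3)} \<subseteq> pos_int_solutions F t) \<and>
      (\<forall>x \<in> pos_int_solutions F t.
         obtained_by_mutations (1, 1, 1) x \<or> obtained_by_mutations (3, 3, 3) x)) \<and>
    (poly F 1 \<noteq> poly F 3 \<longrightarrow>
      (\<exists>a \<in> {(1, 1, 1), (3, 3, 3)}.
         (pos_int_solutions F t \<noteq> {} \<longrightarrow> a \<in> pos_int_solutions F t) \<and>
         (\<forall>x \<in> pos_int_solutions F t. obtained_by_mutations a x)))"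
proof -
  note reach = solution_obtained_from_initial[OF assms]
  have solvable: "pos_int_solutions F t \<noteq> {} \<longleftrightarrow> poly F t = poly F 1 \<or> poly F t = poly F 3"
  proof
    assume "pos_int_solutions F t \<noteq> {}"
    then obtain s where "s \<in> pos_int_solutions F t" by blast
    then show "poly F t = poly F 1 \<or> poly F t = poly F 3" using reach[of s] by blast
  next
    assume "poly F t = poly F 1 \<or> poly F t = poly F 3"
    then have "(3, 3, 3) \<in> pos_int_solutions F t \<or> (1, 1, 1) \<in> pos_int_solutions F t"
      by (simp add: ones_solution_iff threes_solution_iff)
    then show "pos_int_solutions F t \<noteq> {}" by blast
  qed
  have both: "{(1, 1, 1), (3, 3, 3)} \<subseteq> pos_int_solutions F t"
    if "poly F 1 = poly F 3" "pos_int_solutions F t \<noteq> {}"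
    using that solvable by (simp add: ones_solution_iff threes_solution_iff)
  have single: "\<exists>a \<in> {(1, 1, 1), (3, 3, 3)}.
      (pos_int_solutions F t \<noteq> {} \<longrightarrow> a \<in> pos_int_solutions F t) \<and>
      (\<forall>x \<in> pos_int_solutions F t. obtained_by_mutations a x)"
    if ne: "poly F 1 \<noteq> poly F 3"
  proof (cases "poly F t = poly F 3")
    case True
    then have "\<forall>x \<in> pos_int_solutions F t. obtained_by_mutations (1, 1, 1) x"
      using reach ne by metis
    then show ?thesis using True by (simp add: ones_solution_iff)
  next
    case False
    then have "\<forall>x \<in> pos_int_solutions F t. obtained_by_mutations (3, 3, 3) x"
      using reach by metis
    moreover have "pos_int_solutions F t \<noteq> {} \<longrightarrow> (3, 3, 3) \<in> pos_int_solutions F t"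
      using False solvable by (simp add: threes_solution_iff)
    ultimately show ?thesis by blast
  qed
  show ?thesis
  proof (intro conjI impI ballI)
    fix x assume "x \<in> pos_int_solutions F t"
    then show "obtained_by_mutations (1, 1, 1) x \<or> obtained_by_mutations (3, 3, 3) x"
      using reach[of x] by blast
  qed (fact solvable both single)+
qed

end
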